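(* Let $k$ be a positive odd integer. Then there exists a tournament $T$ such that $M_T=\{0\}\cup\{m^2: m \text{ odd},\ 1\le m\le k\}=\{0,1^2,3^2,\dots,k^2\}$, where $M_T$ is the set of determinants of all subtournaments of $T$.
   Context: A tournament is a directed graph with exactly one arc between each pair of distinct vertices. For a tournament $T$ on vertices $v_1,\dots,v_n$, its skew-adjacency matrix is the zero-diagonal matrix $S_T=[s_{ij}]$ with $s_{ij}=-s_{ji}=1$ if there is an arc from $v_i$ to $v_j$, and $\det(T):=\det(S_T)$. A subtournament of $T$ is the tournament induced by a nonempty subset of $V(T)$ (including $T$ itself). *)

theory Defs
  imports "Graph_Theory.Digraph_Component" "Jordan_Normal_Form.Determinant"
begin

locale tournament = digraph G for G :: "('a, 'b) pre_digraph" +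
  assumes unique_arc: "\<lbrakk>u \<in> verts G; v \<in> verts G; u \<noteq> v\<rbrakk> \<Longrightarrow>
    \<exists>!e. e \<in> arcs G \<and> {tail G e, head G e} = {u, v}"

definition skew_adj_mat :: "('a, 'b) pre_digraph \<Rightarrow> 'a list \<Rightarrow> int mat" where
  "skew_adj_mat G vs = mat (length vs) (length vs)
     (\<lambda>(i, j). if vs ! i \<rightarrow>\<^bsub>G\<^esub> vs ! j then 1 else if vs ! j \<rightarrow>\<^bsub>G\<^esub> vs ! i then -1 else 0)"

text \<open>
  The vertices are listed in increasing order; by \<open>tdet_eq\<close> below, every other enumeration
  gives the same determinant.
\<close>

definition tdet :: "('a::linorder, 'b) pre_digraph \<Rightarrow> int" where
  "tdet G = det (skew_adj_mat G (sorted_list_of_set (verts G)))"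

definition subtournament_dets :: "('a::linorder, 'b) pre_digraph \<Rightarrow> int set" where
  "subtournament_dets G = {tdet (G \<restriction> W) | W. W \<subseteq> verts G \<and> W \<noteq> {}}"

lemma det_skew_adj_mat_perm:
  assumes "mset vs = mset ws"
  shows "det (skew_adj_mat G vs) = det (skew_adj_mat G ws)"
proof -
  let ?n = "length ws"
  let ?A = "skew_adj_mat G ws"
  obtain p where p: "p permutes {..<?n}" and vs: "permute_list p ws = vs"
    using assms by (rule mset_eq_permutation)
  have p': "p permutes {0..<?n}"
    using p by (simp add: lessThan_atLeast0)
  have lt: "p i < ?n" if "i < ?n" for i
    using permutes_in_image[OF p, of i] that by simp
  have nth: "vs ! i = ws ! p i" if "i < ?n" for i
    using vs permute_list_nth[OF p that] by simp
  have len: "length vs = ?n"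
    using vs by auto
  define B where "B = mat ?n ?n (\<lambda>(i, j). ?A $$ (p i, j))"
  have A: "?A \<in> carrier_mat ?n ?n"
    by (simp add: skew_adj_mat_def)
  have B: "B \<in> carrier_mat ?n ?n"
    by (simp add: B_def)
  define C where "C = mat ?n ?n (\<lambda>(i, j). transpose_mat B $$ (p i, j))"
  have C: "C \<in> carrier_mat ?n ?n"
    by (simp add: C_def)
  have "skew_adj_mat G vs = transpose_mat C"
    by (rule eq_matI) (auto simp: skew_adj_mat_def B_def C_def len nth lt)
  hence "det (skew_adj_mat G vs) = det C"
    using det_transpose[OF C] by simp
  also have "det C = signof p * det B"
    unfolding C_def det_transpose[OF B, symmetric]
    by (rule det_permute_rows[OF _ p']) (use B in simp)
  also have "det B = signof p * det ?A"
    unfolding B_def by (rule det_permute_rows[OF A p'])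
  finally show ?thesis
    by (simp add: sign_def)
qed

lemma tdet_eq:
  assumes "distinct vs" and "set vs = verts G"
  shows "tdet G = det (skew_adj_mat G vs)"
  unfolding tdet_def
  by (rule det_skew_adj_mat_perm)
     (metis assms set_eq_iff_mset_eq_distinct distinct_sorted_list_of_set
        set_sorted_list_of_set List.finite_set)

end

theory Submission
  imports Defs
begin

text \<open>
  Add one vertex to a transitive tournament on \<open>n\<close> vertices so that the arcs between
  the \<open>i\<close>-th vertex and the new one alternate in direction with \<open>i\<close>. A subtournament of odd order
  has determinant zero, being skew-symmetric. For one of even order, cancelling the first two
  vertices by a Schur complement shows that the Pfaffian is the alternating sum of the signs of
  the arcs into the last vertex. Such a sum has an odd number of terms \<open>\<plusminus>1\<close>, at most \<open>n\<close> of them, so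
  it is odd and at most \<open>n\<close> in absolute value; for odd \<open>m\<close>, the first \<open>m\<close> vertices and the new one give terms
  all equal to \<open>1\<close>, hence the sum \<open>m\<close>.
\<close>

section \<open>Determinants of transitive tournaments extended by one weighted vertex\<close>

text \<open>The extra vertex has index \<open>m\<close>. Its weights are arbitrary ring elements
  because the elimination of other vertices does not keep them in {1, -1}.\<close>

definition cone_mat :: "nat \<Rightarrow> (nat \<Rightarrow> 'a::idom) \<Rightarrow> 'a mat" where
  "cone_mat m w = mat (Suc m) (Suc m)
     (\<lambda>(i, j). if i = j then 0 else if i = m then - w j else if j = m then w i
               else if i < j then 1 else - 1)"

lemma cone_mat_carrier [simp]: "cone_mat m w \<in> carrier_mat (Suc m) (Suc m)"
  by (simp add: cone_mat_def)

lemma cone_mat_dim [simp]: "dim_row (cone_mat m w) = Suc m" "dim_col (cone_mat m w) = Suc m"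
  by (simp_all add: cone_mat_def)

lemma det_2x2:
  fixes A :: "'a::comm_ring_1 mat"
  assumes A: "A \<in> carrier_mat 2 2"
  shows "det A = A $$ (0, 0) * A $$ (1, 1) - A $$ (0, 1) * A $$ (1, 0)"
  using A
  by (subst laplace_expansion_row[of A 2 0])
     (auto simp: numeral_2_eq_2 cofactor_def mat_delete_def det_single)

text \<open>The leading 2 x 2 block is [[0, 1], [-1, 0]], so its Schur complement has the same
  determinant as the whole matrix. Forming it leaves the transitive part intact and shifts every
  weight by \<open>w 0 - w 1\<close>.\<close>

lemma det_cone_mat_Suc_Suc:
  "det (cone_mat (Suc (Suc m)) w) = det (cone_mat m (\<lambda>i. w 0 - w 1 + w (Suc (Suc i))))"
proof -
  let ?M = "cone_mat (Suc (Suc m)) w"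
  let ?w = "\<lambda>i. w 0 - w 1 + w (Suc (Suc i))"
  let ?N = "cone_mat m ?w"
  define J :: "'a mat" where "J = mat 2 2 (\<lambda>(i, j). ?M $$ (i, j))"
  define B where "B = mat 2 (Suc m) (\<lambda>(i, j). ?M $$ (i, j + 2))"
  \<comment> \<open>This is the lower left block of \<open>?M\<close> times the inverse [[0, -1],
    [1, 0]] of \<open>J\<close>, written out without division.\<close>
  define X where
    "X = mat (Suc m) 2 (\<lambda>(i, j). if j = 0 then ?M $$ (i + 2, 1) else - ?M $$ (i + 2, 0))"
  have carr: "J \<in> carrier_mat 2 2" "B \<in> carrier_mat 2 (Suc m)" "X \<in> carrier_mat (Suc m) 2"
    by (simp_all add: J_def B_def X_def)
  let ?P = "four_block_mat (1\<^sub>m 2) (0\<^sub>m 2 (Suc m)) X (1\<^sub>m (Suc m))"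
  let ?Q = "four_block_mat J B (0\<^sub>m (Suc m) 2) ?N"
  have XJ: "(X * J) $$ (i, j) = ?M $$ (i + 2, j)" if "i < Suc m" "j < 2" for i j
  proof -
    have "(X * J) $$ (i, j) = ?M $$ (i + 2, 1) * ?M $$ (0, j) - ?M $$ (i + 2, 0) * ?M $$ (1, j)"
      using that by (simp add: X_def J_def scalar_prod_def numeral_2_eq_2)
    moreover have "j = 0 \<or> j = 1"
      using that by auto
    ultimately show ?thesis
      using that by (elim disjE) (simp_all add: cone_mat_def)
  qed
  \<comment> \<open>Two transitive vertices give (-1, 1) against (1, 1), hence 0. In the last column
    or row, off the corner, the product is \<open>w 0 - w 1\<close> up to sign, which undoes the
    shift in \<open>?w\<close>; in the corner it vanishes.\<close>
  have XB: "(X * B) $$ (i, j) + ?N $$ (i, j) = ?M $$ (i + 2, j + 2)"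
    if "i < Suc m" "j < Suc m" for i j
  proof -
    have "(X * B) $$ (i, j) =
        ?M $$ (i + 2, 1) * ?M $$ (0, j + 2) - ?M $$ (i + 2, 0) * ?M $$ (1, j + 2)"
      using that by (simp add: X_def B_def scalar_prod_def numeral_2_eq_2)
    then show ?thesis
      using that by (simp add: cone_mat_def)
  qed
  \<comment> \<open>In this form the matrix factors as \<open>?P * ?Q\<close>, with
    \<open>?P\<close> unit lower triangular and \<open>?Q\<close> block upper triangular.\<close>
  have "?M = four_block_mat J B (X * J) (X * B + ?N)"
  proof (rule eq_matI)
    fix i j
    assume "i < dim_row (four_block_mat J B (X * J) (X * B + ?N))"
      "j < dim_col (four_block_mat J B (X * J) (X * B + ?N))"
    then have ij: "i < Suc m + 2" "j < Suc m + 2"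
      using carr by auto
    have Suc_Suc: "Suc (Suc (l - 2)) = l" if "\<not> l < 2" for l :: nat
      using that by simp
    from ij have "?M $$ (i, j) =
        (if i < 2 then if j < 2 then J $$ (i, j) else B $$ (i, j - 2)
         else if j < 2 then (X * J) $$ (i - 2, j) else (X * B + ?N) $$ (i - 2, j - 2))"
      using carr XJ[of "i - 2" j] XB[of "i - 2" "j - 2"]
      by (auto simp: J_def B_def Suc_Suc)
    then show "?M $$ (i, j) = four_block_mat J B (X * J) (X * B + ?N) $$ (i, j)"
      using ij carr by simp
  qed (use carr in auto)
  also have "\<dots> = ?P * ?Q"
    using carr by (simp add: mult_four_block_mat[of _ 2 2 _ "Suc m" _ "Suc m" _ _ 2 _ "Suc m"]
        left_mult_one_mat[OF cone_mat_carrier] left_mult_zero_mat[OF cone_mat_carrier])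
  finally have "det ?M = det (?P * ?Q)"
    by simp
  also have "\<dots> = det ?P * det ?Q"
    using carr by (intro det_mult[of _ "2 + Suc m"] four_block_carrier_mat) auto
  also have "det ?P = 1"
    using carr by (subst det_four_block_mat_upper_right_zero) auto
  also have "det ?Q = det J * det ?N"
    using carr by (intro det_four_block_mat_lower_left_zero) auto
  also have "det J = 1"
    by (subst det_2x2) (auto simp: J_def cone_mat_def)
  finally show ?thesis by simp
qed

text \<open>Eliminating vertices in pairs preserves the parity of \<open>m\<close> and ends at a 2 x
  2 matrix. The induction is over all \<open>w\<close>, since each elimination changes the
  weights.\<close>

lemma det_cone_mat:
  assumes "odd m"
  shows "det (cone_mat m w) = (\<Sum>i<m. (-1) ^ i * w i)\<^sup>2"
  using assms
proof (induction m arbitrary: w rule: induct_nat_012)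
  case 0
  then show ?case by simp
next
  case 1
  then show ?case
    by (subst det_2x2) (auto simp: cone_mat_def power2_eq_square)
next
  case (ge2 m)
  \<comment> \<open>An alternating sum of an odd number of ones is 1, so a constant added to all
    weights is counted exactly once. With \<open>c = w 0 - w 1\<close> this restores the first two
    terms.\<close>
  have shift: "(\<Sum>i<m. (-1) ^ i * (c + v i)) = c + (\<Sum>i<m. (-1) ^ i * v i)" for c and v :: "nat \<Rightarrow> 'a"
  proof -
    have "(\<Sum>i<m. (-1) ^ i) = (1 :: 'a)" if "odd m" for m :: nat
      using that by (induction m rule: induct_nat_012) auto
    then show ?thesis
      using ge2.prems by (simp add: distrib_left sum.distrib flip: sum_distrib_right)
  qed
  have "det (cone_mat (Suc (Suc m)) w) =
      (\<Sum>i<m. (-1) ^ i * (w 0 - w 1 + w (Suc (Suc i))))\<^sup>2"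
    using ge2 by (simp add: det_cone_mat_Suc_Suc)
  also have "\<dots> = (\<Sum>i<Suc (Suc m). (-1) ^ i * w i)\<^sup>2"
    unfolding shift by (simp add: sum.lessThan_Suc_shift algebra_simps del: sum.lessThan_Suc)
  finally show ?case .
qed

text \<open>Transposing keeps the determinant while negating multiplies it by
  \<open>(-1) ^ n = -1\<close>; in characteristic 0 this forces it to vanish.\<close>

lemma det_skew_symmetric_odd:
  fixes A :: "'a::{idom, ring_char_0} mat"
  assumes A: "A \<in> carrier_mat n n" and "odd n" and skew: "transpose_mat A = - A"
  shows "det A = 0"
proof -
  have "- A = (-1) \<cdot>\<^sub>m A"
    by (rule eq_matI) auto
  then have "det A = (-1) ^ n * det A"
    using det_transpose[OF A] A skew by simp
  then show ?thesis
    using \<open>odd n\<close> by (simp add: eq_neg_iff_add_eq_0 flip: mult_2)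
qed

section \<open>The alternating tournament\<close>

text \<open>The added vertex gets the largest label \<open>n\<close>, so that the increasing listing
  of any vertex set containing it puts it last, as in \<open>cone_mat\<close>.\<close>

definition alt_rel :: "nat \<Rightarrow> nat \<Rightarrow> nat \<Rightarrow> bool" where
  "alt_rel n i j \<longleftrightarrow> i \<le> n \<and> j \<le> n \<and>
     (if j = n then i < n \<and> even i else if i = n then odd j else i < j)"

definition alt_tournament :: "nat \<Rightarrow> (nat, nat \<times> nat) pre_digraph" where
  "alt_tournament n =
     \<lparr>verts = {..n}, arcs = {(i, j). alt_rel n i j}, tail = fst, head = snd\<rparr>"

lemma alt_tournament_induce_dominates:
  "u \<rightarrow>\<^bsub>alt_tournament n \<restriction> W\<^esub> v \<longleftrightarrow> u \<in> W \<and> v \<in> W \<and> alt_rel n u v"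
  by (force simp: arcs_ends_conv alt_tournament_def)

lemma alt_rel_total: "\<lbrakk>i \<le> n; j \<le> n; i \<noteq> j\<rbrakk> \<Longrightarrow> alt_rel n i j \<or> alt_rel n j i"
  by (auto simp: alt_rel_def)

lemma alt_rel_asym: "alt_rel n i j \<Longrightarrow> \<not> alt_rel n j i"
  by (auto simp: alt_rel_def split: if_splits)

lemma tournament_alt_tournament: "tournament (alt_tournament n)"
proof
  have "arcs (alt_tournament n) \<subseteq> {..n} \<times> {..n}"
    by (auto simp: alt_tournament_def alt_rel_def)
  then show "finite (arcs (alt_tournament n))"
    by (rule finite_subset) simp
next
  fix u v
  assume "u \<in> verts (alt_tournament n)" "v \<in> verts (alt_tournament n)" "u \<noteq> v"
  then show "\<exists>!e. e \<in> arcs (alt_tournament n) \<and>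
      {tail (alt_tournament n) e, head (alt_tournament n) e} = {u, v}"
    by (cases "alt_rel n u v"; intro ex1I[of _ "if alt_rel n u v then (u, v) else (v, u)"])
       (auto simp: alt_tournament_def doubleton_eq_iff dest: alt_rel_asym alt_rel_total)
qed (auto simp: alt_tournament_def alt_rel_def arc_to_ends_def split: if_splits)

section \<open>Determinants of its subtournaments\<close>

lemma tdet_alt_tournament_odd:
  assumes "finite W" "odd (card W)"
  shows "tdet (alt_tournament n \<restriction> W) = 0"
proof -
  let ?vs = "sorted_list_of_set W"
  have "det (skew_adj_mat (alt_tournament n \<restriction> W) ?vs) = 0"
  proof (rule det_skew_symmetric_odd)
    show "transpose_mat (skew_adj_mat (alt_tournament n \<restriction> W) ?vs) =
        - skew_adj_mat (alt_tournament n \<restriction> W) ?vs"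
      by (rule eq_matI)
         (auto simp: skew_adj_mat_def alt_tournament_induce_dominates dest: alt_rel_asym)
  qed (use assms in \<open>auto simp: skew_adj_mat_def\<close>)
  then show ?thesis
    by (simp add: tdet_def)
qed

text \<open>If \<open>x < n\<close>, the subtournament is transitive and its last vertex acts as the
  added one with all weights 1. Thus one formula covers the vertex sets with and without
  \<open>n\<close>.\<close>

lemma tdet_alt_tournament_snoc:
  assumes "sorted_wrt (<) (xs @ [x])" "x \<le> n" "odd (length xs)"
  shows "tdet (alt_tournament n \<restriction> set (xs @ [x])) =
    (\<Sum>i<length xs. (-1) ^ i * (if x = n then (-1) ^ (xs ! i) else 1))\<^sup>2"
proof -
  let ?G = "alt_tournament n \<restriction> set (xs @ [x])"
  let ?w = "\<lambda>i. if x = n then (-1) ^ (xs ! i) else 1 :: int"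
  have lt: "xs ! i < x" if "i < length xs" for i
    using assms(1) that by (auto simp: sorted_wrt_append)
  have mono: "xs ! i < xs ! j" if "i < j" "j < length xs" for i j
    using assms(1) that by (auto simp: sorted_wrt_append dest: sorted_wrt_nth_less)
  have "skew_adj_mat ?G (xs @ [x]) = cone_mat (length xs) ?w"
  proof (rule eq_matI)
    fix i j
    assume "i < dim_row (cone_mat (length xs) ?w)" "j < dim_col (cone_mat (length xs) ?w)"
    then have ij: "i \<le> length xs" "j \<le> length xs"
      by (auto simp: cone_mat_def)
    consider "i = j" | "i = length xs" "j < length xs" | "i < length xs" "j = length xs"
      | "i < j" "j < length xs" | "j < i" "i < length xs"
      using ij by linarith
    then show "skew_adj_mat ?G (xs @ [x]) $$ (i, j) = cone_mat (length xs) ?w $$ (i, j)"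
      using ij assms(2) lt[of i] lt[of j] mono[of i j] mono[of j i]
      by cases (auto simp: skew_adj_mat_def cone_mat_def alt_tournament_induce_dominates
          alt_rel_def nth_append)
  qed (auto simp: skew_adj_mat_def cone_mat_def)
  moreover have "tdet ?G = det (skew_adj_mat ?G (xs @ [x]))"
    using assms(1) by (intro tdet_eq) (auto simp: strict_sorted_iff)
  ultimately show ?thesis
    using assms(3) by (simp add: det_cone_mat)
qed

lemma alternating_sign_sum:
  fixes s :: "nat \<Rightarrow> int"
  assumes "\<And>i. i < m \<Longrightarrow> \<bar>s i\<bar> = 1"
  shows "even ((\<Sum>i<m. (-1) ^ i * s i) + int m)" and "\<bar>\<Sum>i<m. (-1) ^ i * s i\<bar> \<le> int m"
proof -
  have "\<bar>s i\<bar> = 1 \<Longrightarrow> odd (s i)" for i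
    by (metis abs_eq_iff' even_minus odd_one)
  then show "even ((\<Sum>i<m. (-1) ^ i * s i) + int m)"
    using assms by (induction m) auto
  have "\<bar>\<Sum>i<m. (-1) ^ i * s i\<bar> \<le> (\<Sum>i<m. \<bar>(-1) ^ i * s i\<bar>)"
    by (rule sum_abs)
  also have "\<dots> = int m"
    using assms by (simp add: abs_mult power_abs)
  finally show "\<bar>\<Sum>i<m. (-1) ^ i * s i\<bar> \<le> int m" .
qed

lemma tdet_alt_tournament_even:
  assumes W: "W \<subseteq> {..n}" "W \<noteq> {}" "even (card W)"
  shows "\<exists>m. odd m \<and> 1 \<le> m \<and> m \<le> int n \<and> tdet (alt_tournament n \<restriction> W) = m\<^sup>2"
proof -
  have fin: "finite W"
    using W by (auto intro: finite_subset)
  obtain xs x where xs: "sorted_list_of_set W = xs @ [x]"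
    using fin W(2) by (metis rev_exhaust sorted_list_of_set_eq_Nil_iff)
  have set: "set (xs @ [x]) = W" and srt: "sorted_wrt (<) (xs @ [x])"
    using fin by (simp_all flip: xs)
  have len: "Suc (length xs) = card W"
    using arg_cong[OF xs, of length] fin by simp
  have "card W \<le> Suc n"
    using card_mono[OF _ W(1)] by simp
  then have le: "length xs \<le> n" and odd: "odd (length xs)"
    using len W(3) by (auto, presburger)
  \<comment> \<open>The Pfaffian, which may be negative; the witness is its absolute value, positive
    because \<open>s\<close> is odd.\<close>
  define s where "s = (\<Sum>i<length xs. (-1) ^ i * (if x = n then (-1) ^ (xs ! i) else 1 :: int))"
  have "even (s + int (length xs))" "\<bar>s\<bar> \<le> int (length xs)"
    unfolding s_def by (rule alternating_sign_sum; simp add: power_abs)+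
  then have "odd \<bar>s\<bar>" "\<bar>s\<bar> \<le> int n"
    using odd le by auto
  moreover from this have "1 \<le> \<bar>s\<bar>"
    by presburger
  moreover have "tdet (alt_tournament n \<restriction> W) = \<bar>s\<bar>\<^sup>2"
    using tdet_alt_tournament_snoc[OF srt _ odd, of n] W set by (auto simp: s_def)
  ultimately show ?thesis by blast
qed

text \<open>Position \<open>i\<close> of the list holds the vertex \<open>i\<close>, so the sign of
  the position and the sign of the arc agree and every term is 1.\<close>

lemma tdet_alt_tournament_initial:
  assumes "odd m" "m \<le> n"
  shows "tdet (alt_tournament n \<restriction> insert n {..<m}) = (int m)\<^sup>2"
proof -
  have "sorted_wrt (<) ([0..<m] @ [n])"
    using assms by (auto simp: sorted_wrt_append)
  from tdet_alt_tournament_snoc[OF this] assms show ?thesis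
    by (simp add: lessThan_atLeast0 flip: power_mult_distrib)
qed

lemma subtournament_dets_alt_tournament:
  "subtournament_dets (alt_tournament n) =
    {0} \<union> {m\<^sup>2 | m. odd m \<and> 1 \<le> m \<and> m \<le> int n}" (is "?L = ?R")
proof
  have verts: "verts (alt_tournament n) = {..n}"
    by (simp add: alt_tournament_def)
  show "?L \<subseteq> ?R"
  proof
    fix d
    assume "d \<in> ?L"
    then obtain W where W: "W \<subseteq> {..n}" "W \<noteq> {}" and d: "d = tdet (alt_tournament n \<restriction> W)"
      by (auto simp: subtournament_dets_def verts)
    show "d \<in> ?R"
    proof (cases "even (card W)")
      case True
      then show ?thesis
        using tdet_alt_tournament_even[OF W] d by blast
    next
      case False
      then show ?thesis
        using tdet_alt_tournament_odd[of W n] W d by (auto intro: finite_subset)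
    qed
  qed
  show "?R \<subseteq> ?L"
  proof
    fix d
    assume "d \<in> ?R"
    then consider "d = 0" | m where "odd m" "1 \<le> m" "m \<le> int n" "d = m\<^sup>2"
      by blast
    then show "d \<in> ?L"
    proof cases
      case 1
      \<comment> \<open>A single vertex is a subtournament of odd order.\<close>
      then have "d = tdet (alt_tournament n \<restriction> {0})"
        by (simp add: tdet_alt_tournament_odd)
      then show ?thesis
        unfolding subtournament_dets_def verts by blast
    next
      case 2
      then have "d = tdet (alt_tournament n \<restriction> insert n {..<nat m})"
        using tdet_alt_tournament_initial[of "nat m" n] by (simp add: even_nat_iff)
      moreover have "insert n {..<nat m} \<subseteq> {..n}"
        using 2 by auto
      ultimately show ?thesis
        unfolding subtournament_dets_def verts by blast
    qed
  qed
qed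

theorem theorem4p7:
  fixes k :: int
  assumes "k > 0" and "odd k"
  shows "\<exists>T :: (nat, nat \<times> nat) pre_digraph. tournament T \<and>
    subtournament_dets T = {0} \<union> {m\<^sup>2 | m. odd m \<and> 1 \<le> m \<and> m \<le> k}"
proof -
  have "int (nat k) = k"
    using assms by simp
  then show ?thesis
    using tournament_alt_tournament[of "nat k"] subtournament_dets_alt_tournament[of "nat k"] by auto
qed

end
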